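(* Let $d$ be any design on $N$ units satisfying $\pi_i=0.5$ for all $i\in\{1,\dots,N\}$, and let $\beta_1,\dots,\beta_N$ be arbitrary deterministic real numbers. Impute the potential outcomes by $$\hat Y_i(1)=W_iY_i^{\text{obs}}+(1-W_i)(Y_i^{\text{obs}}+\beta_i),\qquad \hat Y_i(0)=W_i(Y_i^{\text{obs}}-\beta_i)+(1-W_i)Y_i^{\text{obs}},$$ and let $\hat c_i=\{\hat Y_i(0)+\hat Y_i(1)\}/2$, $\hat{\bm{c}}=(\hat c_1,\dots,\hat c_N)^\top$. Then the imputation-based variance estimator $\psi(\hat{\bm{c}})$ is conservative regardless of the values of $\beta_1,\dots,\beta_N$ and of the potential outcomes: $$\mathbb{E}_d\{\psi(\hat{\bm{c}})\}\ge\mathrm{Var}_d(\hat\tau).$$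
   Context: There are $N$ units with fixed real potential outcomes $Y_i(0),Y_i(1)$. A design $d$ is a probability distribution of the random assignment $\bm{W}\in\{0,1\}^N$; $p_{\bm{w}}=\Pr_d(\bm{W}=\bm{w})$ and $\pi_i=\Pr_d(W_i=1)$; $\mathbb{E}_d,\mathrm{Var}_d$ are over $\bm{W}$ only. $Y_i^{\text{obs}}=W_iY_i(1)+(1-W_i)Y_i(0)$, and $\hat\tau=\frac1N\sum_iW_iY_i^{\text{obs}}/\pi_i-\frac1N\sum_i(1-W_i)Y_i^{\text{obs}}/(1-\pi_i)$ is the Horvitz–Thompson estimator. For $\bm{x}\in\mathbb{R}^N$, $$\psi(\bm{x})=\sum_{\bm{w}}p_{\bm{w}}\Big\{\frac{\sum_{i:w_i=1}x_i}{N/2}-\frac{\sum_{i:w_i=0}x_i}{N/2}\Big\}^2 .$$ *)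

theory Defs
  imports "HOL-Probability.Probability"
begin

(* The units are the elements of a finite type 'n, so N = CARD('n).  An assignment w in {0,1}^N
   is a predicate on units: "w i" means w_i = 1, and of_bool (w i) is the number w_i. *)

type_synonym 'n assignment = "'n \<Rightarrow> bool"

type_synonym 'n design = "'n assignment pmf"

abbreviation num_units :: "'n::finite itself \<Rightarrow> real" where
  "num_units _ \<equiv> real CARD('n)"

definition propensity :: "'n design \<Rightarrow> 'n \<Rightarrow> real" where
  "propensity d i = measure_pmf.prob d {w. w i}"

(* Throughout, Y0 and Y1 are the vectors of potential outcomes Y_i(0) and Y_i(1). *)

definition Y_obs :: "real ^ 'n \<Rightarrow> real ^ 'n \<Rightarrow> 'n::finite assignment \<Rightarrow> real ^ 'n" where
  "Y_obs Y0 Y1 w = (\<chi> i. of_bool (w i) * Y1 $ i + (1 - of_bool (w i)) * Y0 $ i)"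

definition tau_hat :: "'n::finite design \<Rightarrow> real ^ 'n \<Rightarrow> real ^ 'n \<Rightarrow> 'n assignment \<Rightarrow> real" where
  "tau_hat d Y0 Y1 w =
     1 / num_units TYPE('n) *
       (\<Sum>i\<in>UNIV. of_bool (w i) * Y_obs Y0 Y1 w $ i / propensity d i)
   - 1 / num_units TYPE('n) *
       (\<Sum>i\<in>UNIV. (1 - of_bool (w i)) * Y_obs Y0 Y1 w $ i / (1 - propensity d i))"

definition psi :: "'n::finite design \<Rightarrow> real ^ 'n \<Rightarrow> real" where
  "psi d x =
     (\<Sum>w\<in>UNIV. pmf d w *
        ((\<Sum>i | w i. x $ i) / (num_units TYPE('n) / 2)
       - (\<Sum>i | \<not> w i. x $ i) / (num_units TYPE('n) / 2))\<^sup>2)"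

definition Y1_hat ::
    "real ^ 'n \<Rightarrow> real ^ 'n \<Rightarrow> real ^ 'n \<Rightarrow> 'n::finite assignment \<Rightarrow> real ^ 'n" where
  "Y1_hat \<beta> Y0 Y1 w =
     (\<chi> i. of_bool (w i) * Y_obs Y0 Y1 w $ i
          + (1 - of_bool (w i)) * (Y_obs Y0 Y1 w $ i + \<beta> $ i))"

definition Y0_hat ::
    "real ^ 'n \<Rightarrow> real ^ 'n \<Rightarrow> real ^ 'n \<Rightarrow> 'n::finite assignment \<Rightarrow> real ^ 'n" where
  "Y0_hat \<beta> Y0 Y1 w =
     (\<chi> i. of_bool (w i) * (Y_obs Y0 Y1 w $ i - \<beta> $ i)
          + (1 - of_bool (w i)) * Y_obs Y0 Y1 w $ i)"

definition c_hat ::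
    "real ^ 'n \<Rightarrow> real ^ 'n \<Rightarrow> real ^ 'n \<Rightarrow> 'n::finite assignment \<Rightarrow> real ^ 'n" where
  "c_hat \<beta> Y0 Y1 w = (\<chi> i. (Y0_hat \<beta> Y0 Y1 w $ i + Y1_hat \<beta> Y0 Y1 w $ i) / 2)"

end

(* With s_i = 2 W_i - 1, both sides are values of the quadratic form psi: the variance is psi(c)
   for the true c = (Y(0) + Y(1)) / 2, and the imputed vector is c plus a perturbation
   s_i (Y_i(1) - Y_i(0) - \<beta>_i) / 2.  The perturbation has mean zero because \<pi>_i = 1/2, so the
   inequality is Jensen's inequality for the convex function psi. *)

theory Submission
  imports Defs
begin

definition assignment_sign :: "('n \<Rightarrow> bool) \<Rightarrow> 'n \<Rightarrow> real" where
  "assignment_sign w i = (if w i then 1 else - 1)"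

lemma expectation_finite_type:
  fixes d :: "'a::finite pmf" and f :: "'a \<Rightarrow> real"
  shows "measure_pmf.expectation d f = (\<Sum>w\<in>UNIV. pmf d w * f w)"
  by (subst integral_measure_pmf_real[of UNIV]) (auto simp: mult.commute)

lemma expectation_assignment_sign:
  fixes d :: "'n::finite design"
  assumes "propensity d i = 1 / 2"
  shows "measure_pmf.expectation d (\<lambda>w. assignment_sign w i) = 0"
proof -
  have sign: "assignment_sign w i = 2 * indicator {w. w i} w - 1" for w
    by (simp add: assignment_sign_def)
  have "integrable (measure_pmf d) (indicator {w. w i} :: _ \<Rightarrow> real)"
    by (simp add: integrable_measure_pmf_finite)
  then show ?thesis
    using assms by (simp add: sign propensity_def)
qed

text \<open>The signs merge the two group sums into one linear form in \<open>x\<close>, so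
  \<open>psi d\<close> is a mean of squared linear forms. Both its convexity and its link to the
  variance are read off from this shape.\<close>

lemma psi_eq_expectation:
  fixes x :: "real ^ 'n::finite"
  shows "psi d x = measure_pmf.expectation d
           (\<lambda>w. (2 / real CARD('n) * (\<Sum>i\<in>UNIV. assignment_sign w i * x $ i))\<^sup>2)"
proof -
  have "(\<Sum>i | w i. x $ i) / (real CARD('n) / 2) - (\<Sum>i | \<not> w i. x $ i) / (real CARD('n) / 2)
          = 2 / real CARD('n) * (\<Sum>i\<in>UNIV. assignment_sign w i * x $ i)" for w
  proof -
    have "(\<Sum>i\<in>UNIV. assignment_sign w i * x $ i)
            = (\<Sum>i\<in>UNIV. (if w i then x $ i else 0) - (if \<not> w i then x $ i else 0))"
      by (intro sum.cong) (auto simp: assignment_sign_def)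
    also have "\<dots> = (\<Sum>i | w i. x $ i) - (\<Sum>i | \<not> w i. x $ i)"
      by (simp only: sum_subtractf sum.inter_filter[symmetric] finite UNIV_I simp_thms)
    finally show ?thesis
      by (simp add: field_simps)
  qed
  then show ?thesis
    unfolding psi_def expectation_finite_type by simp
qed

text \<open>Convexity in supporting-hyperplane form: with an affine lower bound, Jensen's inequality
  reduces to linearity of expectation.\<close>

lemma psi_subgradient:
  fixes x :: "real ^ 'n::finite"
  obtains g :: "real ^ 'n" where "\<And>y. psi d (x + y) \<ge> psi d x + (\<Sum>i\<in>UNIV. g $ i * y $ i)"
proof -
  define L where
    "L w y = 2 / real CARD('n) * (\<Sum>i\<in>UNIV. assignment_sign w i * y $ i)"
    for w :: "'n assignment" and y :: "real ^ 'n"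
  \<comment> \<open>The gradient of \<open>psi d\<close> at \<open>x\<close>: \<open>L w\<close> is
    linear with coefficients \<open>2 / N * s_i\<close>, and the chain rule is applied to its
    square.\<close>
  define g :: "real ^ 'n" where
    "g = (\<chi> i. \<Sum>w\<in>UNIV. pmf d w * (2 * L w x * (2 / real CARD('n) * assignment_sign w i)))"
  have psi: "psi d y = (\<Sum>w\<in>UNIV. pmf d w * (L w y)\<^sup>2)" for y
    by (simp add: psi_eq_expectation expectation_finite_type L_def)
  have "psi d x + (\<Sum>i\<in>UNIV. g $ i * y $ i) \<le> psi d (x + y)" for y
  proof -
    have "(\<Sum>i\<in>UNIV. g $ i * y $ i) = (\<Sum>w\<in>UNIV. \<Sum>i\<in>UNIV.
            pmf d w * (2 * L w x * (2 / real CARD('n) * assignment_sign w i)) * y $ i)"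
      unfolding g_def vec_lambda_beta sum_distrib_right by (rule sum.swap)
    also have "\<dots> = (\<Sum>w\<in>UNIV. pmf d w * (2 * L w x * L w y))"
      by (simp add: L_def[of _ y] sum_distrib_left mult.assoc)
    finally have "psi d x + (\<Sum>i\<in>UNIV. g $ i * y $ i)
        = (\<Sum>w\<in>UNIV. pmf d w * ((L w x)\<^sup>2 + 2 * L w x * L w y))"
      by (simp add: psi sum.distrib distrib_left)
    \<comment> \<open>The gap for each \<open>w\<close> is the remaining square
      \<open>(L w y)\<^sup>2\<close>.\<close>
    also have "\<dots> \<le> (\<Sum>w\<in>UNIV. pmf d w * (L w (x + y))\<^sup>2)"
    proof (intro sum_mono mult_left_mono)
      fix w
      have "L w (x + y) = L w x + L w y"
        by (simp add: L_def sum.distrib distrib_left)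
      then show "(L w x)\<^sup>2 + 2 * L w x * L w y \<le> (L w (x + y))\<^sup>2"
        by (simp add: power2_sum)
    qed simp
    finally show ?thesis
      by (simp add: psi)
  qed
  then show thesis
    by (rule that)
qed

text \<open>Only the missing outcome is imputed, and its error is \<plusminus>(Y_i(1) - Y_i(0) -
  \<beta>_i): the assignment decides the sign but not the size.\<close>

lemma c_hat_eq:
  "c_hat \<beta> Y0 Y1 w = (\<chi> i. (Y0 $ i + Y1 $ i) / 2)
     + (\<chi> i. assignment_sign w i * ((Y1 $ i - Y0 $ i - \<beta> $ i) / 2))"
  by (auto simp: vec_eq_iff c_hat_def Y0_hat_def Y1_hat_def Y_obs_def assignment_sign_def
      field_simps)

text \<open>Both inverse weights are 2, so a unit contributes 2 Y_i(1) if treated and -2 Y_i(0)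
  otherwise; either value is s_i (Y_i(0) + Y_i(1)) + (Y_i(1) - Y_i(0)).\<close>

lemma tau_hat_eq:
  fixes d :: "'n::finite design"
  assumes "\<And>i. propensity d i = 1 / 2"
  shows "tau_hat d Y0 Y1 w
    = 2 / real CARD('n) * (\<Sum>i\<in>UNIV. assignment_sign w i * ((Y0 $ i + Y1 $ i) / 2))
      + (\<Sum>i\<in>UNIV. Y1 $ i - Y0 $ i) / real CARD('n)"
proof -
  have "tau_hat d Y0 Y1 w = 1 / real CARD('n) *
      (\<Sum>i\<in>UNIV. of_bool (w i) * Y_obs Y0 Y1 w $ i / (1 / 2)
        - (1 - of_bool (w i)) * Y_obs Y0 Y1 w $ i / (1 / 2))"
    unfolding tau_hat_def assms by (simp add: sum_subtractf right_diff_distrib)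
  also have "(\<Sum>i\<in>UNIV. of_bool (w i) * Y_obs Y0 Y1 w $ i / (1 / 2)
        - (1 - of_bool (w i)) * Y_obs Y0 Y1 w $ i / (1 / 2))
      = (\<Sum>i\<in>UNIV. 2 * (assignment_sign w i * ((Y0 $ i + Y1 $ i) / 2)) + (Y1 $ i - Y0 $ i))"
    by (intro sum.cong) (auto simp: Y_obs_def assignment_sign_def)
  also have "\<dots> = 2 * (\<Sum>i\<in>UNIV. assignment_sign w i * ((Y0 $ i + Y1 $ i) / 2))
      + (\<Sum>i\<in>UNIV. Y1 $ i - Y0 $ i)"
    by (simp only: sum.distrib sum_distrib_left)
  finally show ?thesis
    by (simp add: distrib_left)
qed

text \<open>The signs have mean zero, so centring \<open>tau_hat\<close> removes exactly the
  constant average effect and leaves the linear form whose mean square is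
  \<open>psi d\<close>.\<close>

lemma variance_tau_hat:
  fixes d :: "'n::finite design"
  assumes "\<And>i. propensity d i = 1 / 2"
  shows "measure_pmf.variance d (tau_hat d Y0 Y1) = psi d (\<chi> i. (Y0 $ i + Y1 $ i) / 2)"
proof -
  have "measure_pmf.expectation d (tau_hat d Y0 Y1) = (\<Sum>i\<in>UNIV. Y1 $ i - Y0 $ i) / real CARD('n)"
    unfolding tau_hat_eq[OF assms, abs_def]
    by (simp add: integrable_measure_pmf_finite expectation_assignment_sign[OF assms]
        del: times_divide_eq_right)
  then show ?thesis
    by (simp add: psi_eq_expectation tau_hat_eq[OF assms])
qed

theorem mainTheorem6:
  fixes d :: "'n::finite design"
    and \<beta> Y0 Y1 :: "real ^ 'n"
  assumes "\<And>i. propensity d i = 1 / 2"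
  shows "measure_pmf.expectation d (\<lambda>w. psi d (c_hat \<beta> Y0 Y1 w))
           \<ge> measure_pmf.variance d (tau_hat d Y0 Y1)"
proof -
  define c :: "real ^ 'n" where "c = (\<chi> i. (Y0 $ i + Y1 $ i) / 2)"
  define \<delta> where "\<delta> i = (Y1 $ i - Y0 $ i - \<beta> $ i) / 2" for i
  \<comment> \<open>The tangent is taken at the nonrandom \<open>c\<close>, so \<open>g\<close> does
    not depend on \<open>w\<close>.\<close>
  obtain g where g: "\<And>y. psi d (c + y) \<ge> psi d c + (\<Sum>i\<in>UNIV. g $ i * y $ i)"
    using psi_subgradient[of d c] by blast
  \<comment> \<open>As \<open>g\<close> and \<open>\<delta>\<close> are constant in
    \<open>w\<close>, the linear term is a fixed combination of mean-zero signs.\<close>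
  have "psi d c = measure_pmf.expectation d
      (\<lambda>w. psi d c + (\<Sum>i\<in>UNIV. g $ i * (assignment_sign w i * \<delta> i)))"
    by (simp add: integrable_measure_pmf_finite expectation_assignment_sign[OF assms])
  also have "\<dots> \<le> measure_pmf.expectation d (\<lambda>w. psi d (c_hat \<beta> Y0 Y1 w))"
  proof (intro integral_mono)
    fix w
    show "psi d c + (\<Sum>i\<in>UNIV. g $ i * (assignment_sign w i * \<delta> i)) \<le> psi d (c_hat \<beta> Y0 Y1 w)"
      using g[of "\<chi> i. assignment_sign w i * \<delta> i"] by (simp add: c_hat_eq c_def \<delta>_def)
  qed (simp_all add: integrable_measure_pmf_finite)
  finally show ?thesis
    by (simp add: variance_tau_hat[OF assms] c_def)
qed

end
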